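(* Let $d \geq 3$ be odd. Then there exists a homogeneous form of degree $d$ in $3$ variables over $\mathbb{C}$ whose Waring rank is strictly greater than $((d+1)/2)^2$. Equivalently, $r_{\max}(3,d) > ((d+1)/2)^2$.
   Context: For a complex homogeneous form $F$ of degree $d$, the Waring rank $r(F)$ is the least $r$ such that there exist linear forms $\ell_1,\dots,\ell_r$ and scalars $c_1,\dots,c_r\in\mathbb{C}$ with $F = c_1\ell_1^d+\dots+c_r\ell_r^d$. $r_{\max}(n,d)$ denotes the maximum Waring rank among all homogeneous forms of degree $d$ in $n$ variables over $\mathbb{C}$. (The number $((d+1)/2)^2$ is the largest Waring rank of a monomial of odd degree $d$ in $3$ variables.) *)

theory Defs
  imports Complex_Main
begin

text \<open>A ternary form of degree d over the complex numbers, given by its coefficients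
  a(i,j,k) on the monomials x^i y^j z^k with i+j+k = d, viewed as a polynomial function
  (polynomials and polynomial functions agree over the infinite field C).\<close>
definition form3 :: "nat \<Rightarrow> (nat \<times> nat \<times> nat \<Rightarrow> complex) \<Rightarrow> (complex \<Rightarrow> complex \<Rightarrow> complex \<Rightarrow> complex)" where
  "form3 d a = (\<lambda>x y z. \<Sum>i\<le>d. \<Sum>j\<le>d - i. a (i, j, d - i - j) * x ^ i * y ^ j * z ^ (d - i - j))"

definition waring_decomp :: "nat \<Rightarrow> (complex \<Rightarrow> complex \<Rightarrow> complex \<Rightarrow> complex) \<Rightarrow> nat \<Rightarrow> bool" where
  "waring_decomp d F r \<longleftrightarrow>
     (\<exists>(c :: nat \<Rightarrow> complex) (\<alpha> :: nat \<Rightarrow> complex) (\<beta> :: nat \<Rightarrow> complex) (\<gamma> :: nat \<Rightarrow> complex).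
        \<forall>x y z. F x y z = (\<Sum>t<r. c t * (\<alpha> t * x + \<beta> t * y + \<gamma> t * z) ^ d))"

definition waring_rank :: "nat \<Rightarrow> (complex \<Rightarrow> complex \<Rightarrow> complex \<Rightarrow> complex) \<Rightarrow> nat" where
  "waring_rank d F = (LEAST r. waring_decomp d F r)"

end

theory Submission
  imports Defs
begin

text \<open>
  Write \<open>d = 2k + 1\<close> and let \<open>F\<close> be \<open>x y\<^bsup>k-1\<^esup> z\<^bsup>k+1\<^esup> + y\<^bsup>2k\<^esup> z\<close>, each monomial weighted by its
  multinomial coefficient. Suppose that \<open>F\<close> is a combination of the \<open>d\<close>-th powers of \<open>r\<close> linear
  forms, seen as points of the dual plane with coordinates \<open>X, Y, Z\<close>. A form of degree at most \<open>d\<close>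
  vanishing at all of these points annihilates \<open>F\<close> by differentiation.

  Suppose a combination of the \<open>k(k+2)\<close> monomials \<open>Y\<^bsup>a\<^esup> Z\<^bsup>b\<^esup>\<close> with \<open>a < k\<close>, \<open>b < k + 2\<close>, homogenised
  by \<open>X\<close>, vanishes at the points off the line \<open>X = 0\<close>. Multiplied by \<open>X\<close> it vanishes at all the points,
  so it annihilates the \<open>x\<close>-derivative \<open>y\<^bsup>k-1\<^esup> z\<^bsup>k+1\<^esup>\<close> of \<open>F\<close>; hence its part free of \<open>X\<close> is zero, and by
  descent so is the combination. Thus at least \<open>k(k+2) = (k+1)\<^sup>2 - 1\<close> points lie off that line.
  The term \<open>y\<^bsup>2k\<^esup> z\<close> makes the argument work with the additional monomials \<open>Y\<^bsup>k\<^esup>\<close> and \<open>Y\<^bsup>k\<^esup> Z\<close> if no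
  point lies on the line \<open>X = 0\<close>, and with \<open>Y\<^bsup>k\<^esup>\<close> if exactly one does. In every case
  \<open>r \<ge> (k+1)\<^sup>2 + 1\<close>.
\<close>

section \<open>Linear systems\<close>

lemma underdetermined_system_nontrivial:
  fixes f :: "'t \<Rightarrow> 'p \<Rightarrow> 'a::field"
  assumes "finite T" "finite P" "card T < card P"
  shows "\<exists>e. (\<exists>p\<in>P. e p \<noteq> 0) \<and> (\<forall>t\<in>T. (\<Sum>p\<in>P. e p * f t p) = 0)"
  using assms
proof (induction T arbitrary: P f rule: finite_induct)
  case empty
  then have "P \<noteq> {}" by auto
  then show ?case by (intro exI[of _ "\<lambda>_. 1"]) auto
next
  case (insert t T)
  show ?case
  proof (cases "\<forall>p\<in>P. f t p = 0")
    case True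
    have "card T < card P" using insert by simp
    from insert.IH[OF insert.prems(1) this, of f] obtain e
      where "\<exists>p\<in>P. e p \<noteq> 0" "\<forall>t\<in>T. (\<Sum>p\<in>P. e p * f t p) = 0" by blast
    with True show ?thesis by (intro exI[of _ e]) auto
  next
    case False
    then obtain q where q: "q \<in> P" "f t q \<noteq> 0" by blast
    let ?P = "P - {q}"
    have "finite ?P" "card T < card ?P" using insert q by auto
    \<comment> \<open>Gaussian elimination: equation \<open>t\<close> is solved for the unknown
      \<open>q\<close> and substituted into the others; \<open>e'\<close> below restores the value
      at \<open>q\<close>.\<close>
    from insert.IH[OF this, of "\<lambda>s p. f s p - f t p * f s q / f t q"] obtain e
      where e: "\<exists>p\<in>?P. e p \<noteq> 0"
        "\<forall>s\<in>T. (\<Sum>p\<in>?P. e p * (f s p - f t p * f s q / f t q)) = 0" by blast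
    define e' where "e' = e(q := - (\<Sum>p\<in>?P. e p * f t p) / f t q)"
    have expand: "(\<Sum>p\<in>P. e' p * f s p)
        = - (\<Sum>p\<in>?P. e p * f t p) / f t q * f s q + (\<Sum>p\<in>?P. e p * f s p)" for s
    proof -
      have "(\<Sum>p\<in>P. e' p * f s p) = e' q * f s q + (\<Sum>p\<in>?P. e' p * f s p)"
        using insert.prems(1) q(1) by (rule sum.remove)
      moreover have "(\<Sum>p\<in>?P. e' p * f s p) = (\<Sum>p\<in>?P. e p * f s p)"
        by (rule sum.cong) (auto simp: e'_def)
      ultimately show ?thesis by (simp add: e'_def)
    qed
    have "(\<Sum>p\<in>P. e' p * f s p) = 0" if "s \<in> T" for s
    proof -
      have "0 = (\<Sum>p\<in>?P. e p * f s p) - (\<Sum>p\<in>?P. e p * f t p * (f s q / f t q))"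
        using e(2) that by (simp add: algebra_simps sum_subtractf)
      also have "(\<Sum>p\<in>?P. e p * f t p * (f s q / f t q)) = (\<Sum>p\<in>?P. e p * f t p) * (f s q / f t q)"
        by (simp only: sum_distrib_right)
      finally show ?thesis unfolding expand by simp
    qed
    moreover have "(\<Sum>p\<in>P. e' p * f t p) = 0" unfolding expand using q by simp
    moreover have "\<exists>p\<in>P. e' p \<noteq> 0" using e(1) by (auto simp: e'_def)
    ultimately show ?thesis by blast
  qed
qed

text \<open>Subtraction truncates, so this is a form of degree \<open>m\<close> only if
  \<open>e\<close> vanishes on the pairs of \<open>P\<close> with \<open>a + b > m\<close>.\<close>

definition homogenization ::
    "(nat \<times> nat) set \<Rightarrow> (nat \<times> nat \<Rightarrow> 'a::comm_semiring_1) \<Rightarrow> nat \<Rightarrow> 'a \<Rightarrow> 'a \<Rightarrow> 'a \<Rightarrow> 'a" where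
  "homogenization P e m x y z = (\<Sum>(a, b)\<in>P. e (a, b) * (x ^ (m - a - b) * y ^ a * z ^ b))"

text \<open>Off the line X = 0 one may pass to the affine coordinates \<beta>/\<alpha>,
  \<gamma>/\<alpha> and solve a linear system for \<open>e\<close>. Taking \<open>m\<close> as the
  largest degree in the support of \<open>e\<close> makes the part free of X nonzero, so the descent
  by powers of X is built into the choice of \<open>m\<close>.\<close>

lemma exists_vanishing_form:
  fixes \<alpha> \<beta> \<gamma> :: "'t \<Rightarrow> 'a::field"
  assumes "finite T" "finite P" "card T < card P" and nz: "\<And>t. t \<in> T \<Longrightarrow> \<alpha> t \<noteq> 0"
  obtains e :: "nat \<times> nat \<Rightarrow> 'a" and m a b
  where "\<forall>a b. (a, b) \<in> P \<longrightarrow> e (a, b) \<noteq> 0 \<longrightarrow> a + b \<le> m"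
    and "(a, b) \<in> P" "a + b = m" "e (a, b) \<noteq> 0"
    and "\<forall>t\<in>T. homogenization P e m (\<alpha> t) (\<beta> t) (\<gamma> t) = 0"
proof -
  obtain e where e: "\<exists>p\<in>P. e p \<noteq> 0"
      "\<forall>t\<in>T. (\<Sum>p\<in>P. e p * ((\<beta> t / \<alpha> t) ^ fst p * (\<gamma> t / \<alpha> t) ^ snd p)) = 0"
    using underdetermined_system_nontrivial[OF assms(1-3),
        of "\<lambda>t p. (\<beta> t / \<alpha> t) ^ fst p * (\<gamma> t / \<alpha> t) ^ snd p"] by blast
  define D where "D = (\<lambda>p. fst p + snd p) ` {p \<in> P. e p \<noteq> 0}"
  have D: "finite D" "D \<noteq> {}" using assms(2) e(1) by (auto simp: D_def)
  have le: "a + b \<le> Max D" if "(a, b) \<in> P" "e (a, b) \<noteq> 0" for a b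
    using that D(1) by (intro Max_ge) (force simp: D_def)+
  have "Max D \<in> D" using D by (rule Max_in)
  then obtain a b where ab: "(a, b) \<in> P" "a + b = Max D" "e (a, b) \<noteq> 0"
    by (auto simp: D_def)
  have "homogenization P e (Max D) (\<alpha> t) (\<beta> t) (\<gamma> t) = 0" if "t \<in> T" for t
  proof -
    have "homogenization P e (Max D) (\<alpha> t) (\<beta> t) (\<gamma> t)
        = (\<Sum>p\<in>P. \<alpha> t ^ Max D * (e p * ((\<beta> t / \<alpha> t) ^ fst p * (\<gamma> t / \<alpha> t) ^ snd p)))"
      unfolding homogenization_def
    proof (rule sum.cong[OF refl], clarify)
      fix a b assume "(a, b) \<in> P"
      show "e (a, b) * (\<alpha> t ^ (Max D - a - b) * \<beta> t ^ a * \<gamma> t ^ b)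
          = \<alpha> t ^ Max D * (e (a, b) * ((\<beta> t / \<alpha> t) ^ fst (a, b) * (\<gamma> t / \<alpha> t) ^ snd (a, b)))"
      proof (cases "e (a, b) = 0")
        case False
        then have "Max D = (Max D - a - b) + a + b" using le \<open>(a, b) \<in> P\<close> by force
        then have "\<alpha> t ^ Max D = \<alpha> t ^ (Max D - a - b) * \<alpha> t ^ a * \<alpha> t ^ b"
          by (metis power_add)
        then show ?thesis using nz[OF that] by (simp add: power_divide field_simps)
      qed simp
    qed
    also have "\<dots> = 0" using e(2) that by (simp flip: sum_distrib_left)
    finally show ?thesis .
  qed
  with le ab show ?thesis by (intro that[of e "Max D" a b]) auto
qed

section \<open>Moments of a power sum\<close>

lemma linear_power_eq_form3:
  "(\<alpha> * x + \<beta> * y + \<gamma> * z) ^ d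
    = form3 d (\<lambda>(i, j, l). of_nat (d choose i) * of_nat ((d - i) choose j) * (\<alpha> ^ i * \<beta> ^ j * \<gamma> ^ l)) x y z"
proof -
  have "(\<alpha> * x + \<beta> * y + \<gamma> * z) ^ d = (\<alpha> * x + (\<beta> * y + \<gamma> * z)) ^ d" by (simp add: add.assoc)
  also have "\<dots> = (\<Sum>i\<le>d. of_nat (d choose i) * (\<alpha> * x) ^ i * (\<beta> * y + \<gamma> * z) ^ (d - i))"
    by (rule binomial_ring)
  also have "\<dots> = (\<Sum>i\<le>d. of_nat (d choose i) * (\<alpha> * x) ^ i *
      (\<Sum>j\<le>d - i. of_nat ((d - i) choose j) * (\<beta> * y) ^ j * (\<gamma> * z) ^ (d - i - j)))"
    by (simp only: binomial_ring)
  also have "\<dots> = form3 d (\<lambda>(i, j, l). of_nat (d choose i) * of_nat ((d - i) choose j) *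
      (\<alpha> ^ i * \<beta> ^ j * \<gamma> ^ l)) x y z"
    unfolding form3_def sum_distrib_left
    by (intro sum.cong refl) (simp add: power_mult_distrib mult_ac)
  finally show ?thesis .
qed

lemma form3_sum:
  "(\<Sum>t\<in>T. form3 d (f t) x y z) = form3 d (\<lambda>p. \<Sum>t\<in>T. f t p) x y z"
proof -
  have "(\<Sum>t\<in>T. form3 d (f t) x y z) = (\<Sum>i\<le>d. \<Sum>t\<in>T. \<Sum>j\<le>d - i.
      f t (i, j, d - i - j) * x ^ i * y ^ j * z ^ (d - i - j))"
    unfolding form3_def by (rule sum.swap)
  also have "\<dots> = (\<Sum>i\<le>d. \<Sum>j\<le>d - i. \<Sum>t\<in>T.
      f t (i, j, d - i - j) * x ^ i * y ^ j * z ^ (d - i - j))"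
    by (intro sum.cong refl sum.swap)
  finally show ?thesis by (simp add: form3_def sum_distrib_right)
qed

lemma form3_cmult: "c * form3 d a x y z = form3 d (\<lambda>p. c * a p) x y z"
  by (simp add: form3_def sum_distrib_left mult_ac)

text \<open>Setting z = 1 loses nothing, since i and j determine the exponent of z; coefficients are
  then compared in x and afterwards in y.\<close>

lemma form3_coeffs_eq:
  assumes eq: "\<And>x y z. form3 d a x y z = form3 d b x y z" and "i + j + l = d"
  shows "a (i, j, l) = b (i, j, l)"
proof -
  have "(\<Sum>j\<le>d - i. a (i, j, d - i - j) * y ^ j) = (\<Sum>j\<le>d - i. b (i, j, d - i - j) * y ^ j)" for y
  proof -
    have form: "form3 d f x y 1 = (\<Sum>i\<le>d. (\<Sum>j\<le>d - i. f (i, j, d - i - j) * y ^ j) * x ^ i)" for f x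
      unfolding form3_def sum_distrib_right by (intro sum.cong refl) (simp add: mult_ac)
    have "\<forall>i\<le>d. (\<Sum>j\<le>d - i. a (i, j, d - i - j) * y ^ j) = (\<Sum>j\<le>d - i. b (i, j, d - i - j) * y ^ j)"
      using eq[of _ y 1] unfolding form by (intro polyfun_eq_coeffs[THEN iffD1] allI)
    then show ?thesis using assms(2) by simp
  qed
  then have "\<forall>j\<le>d - i. a (i, j, d - i - j) = b (i, j, d - i - j)"
    by (intro polyfun_eq_coeffs[THEN iffD1] allI)
  moreover have "j \<le> d - i" "d - i - j = l" using assms(2) by auto
  ultimately show ?thesis by metis
qed

text \<open>The two binomials multiply to the multinomial coefficient. With it split off, a
  \<open>d\<close>-th power of a linear form has as its \<open>M\<close> the plain monomials in
  \<alpha>, \<beta>, \<gamma>.\<close>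

definition multinomial_form :: "nat \<Rightarrow> (nat \<Rightarrow> nat \<Rightarrow> nat \<Rightarrow> complex) \<Rightarrow> nat \<times> nat \<times> nat \<Rightarrow> complex" where
  "multinomial_form d M = (\<lambda>(i, j, l). of_nat (d choose i) * of_nat ((d - i) choose j) * M i j l)"

lemma power_sum_eq_multinomial_form:
  "(\<Sum>t\<in>T. c t * (\<alpha> t * x + \<beta> t * y + \<gamma> t * z) ^ d)
    = form3 d (multinomial_form d (\<lambda>i j l. \<Sum>t\<in>T. c t * (\<alpha> t ^ i * \<beta> t ^ j * \<gamma> t ^ l))) x y z"
  unfolding linear_power_eq_form3 form3_cmult form3_sum multinomial_form_def
  by (rule arg_cong[where f = "\<lambda>a. form3 d a x y z"])
    (auto simp: fun_eq_iff sum_distrib_left mult_ac)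

lemma moments_of_decomposition:
  assumes "\<And>x y z. form3 d (multinomial_form d M) x y z
      = (\<Sum>t\<in>T. c t * (\<alpha> t * x + \<beta> t * y + \<gamma> t * z) ^ d)" and "i + j + l = d"
  shows "(\<Sum>t\<in>T. c t * (\<alpha> t ^ i * \<beta> t ^ j * \<gamma> t ^ l)) = M i j l"
proof -
  have "multinomial_form d M (i, j, l)
      = multinomial_form d (\<lambda>i j l. \<Sum>t\<in>T. c t * (\<alpha> t ^ i * \<beta> t ^ j * \<gamma> t ^ l)) (i, j, l)"
    using assms(1) unfolding power_sum_eq_multinomial_form by (rule form3_coeffs_eq[OF _ assms(2)])
  moreover have "d choose i \<noteq> 0" "(d - i) choose j \<noteq> 0" using assms(2) by auto
  ultimately show ?thesis by (simp add: multinomial_form_def)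
qed

section \<open>Existence of decompositions\<close>

text \<open>Discrete Fourier inversion: \<open>s\<close> runs through the roots of unity of order n
  + 1, so the exponents 0, ..., n are told apart.\<close>

lemma roots_of_unity_extract:
  fixes n j\<^sub>0 :: nat
  assumes "j\<^sub>0 \<le> n"
  obtains w s :: "nat \<Rightarrow> complex"
  where "\<And>j. j \<le> n \<Longrightarrow> (\<Sum>p\<le>n. w p * s p ^ j) = (if j = j\<^sub>0 then 1 else 0)"
proof -
  define N where "N = Suc n"
  define s where "s p = cis (2 * pi * real p / real N)" for p
  have nz: "s p \<noteq> 0" for p by (simp add: s_def)
  have swap: "s p ^ j = s j ^ p" for p j by (simp add: s_def DeMoivre mult_ac)
  have root: "s p ^ N = 1" for p
  proof -
    have "real N * (2 * pi * real p / real N) = 2 * pi * real p" by (simp add: N_def)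
    then show ?thesis by (simp only: s_def DeMoivre) (simp add: cis_multiple_2pi)
  qed
  have inj: "inj_on s {..<N}"
    using bij_betw_roots_unity[of N] unfolding s_def N_def bij_betw_def by simp
  have "(\<Sum>p\<le>n. (1 / (of_nat N * s j\<^sub>0 ^ p)) * s p ^ j) = (if j = j\<^sub>0 then 1 else 0)" if "j \<le> n" for j
  proof -
    define q where "q = s j / s j\<^sub>0"
    have "(\<Sum>p\<le>n. (1 / (of_nat N * s j\<^sub>0 ^ p)) * s p ^ j) = (\<Sum>p<N. q ^ p) / of_nat N"
      unfolding sum_divide_distrib N_def q_def lessThan_Suc_atMost
      by (intro sum.cong refl) (simp add: swap[of _ j] power_divide mult_ac)
    also have "\<dots> = (if j = j\<^sub>0 then 1 else 0)"
    proof (cases "j = j\<^sub>0")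
      case True
      then show ?thesis using nz[of j] by (simp add: q_def N_def del: of_nat_Suc)
    next
      case False
      then have "s j \<noteq> s j\<^sub>0" using inj_onD[OF inj] that assms by (force simp: N_def)
      then have "q \<noteq> 1" using nz by (simp add: q_def)
      moreover have "q ^ N = 1" by (simp add: q_def power_divide root)
      ultimately show ?thesis using False geometric_sum[of q N] by simp
    qed
    finally show ?thesis .
  qed
  then show ?thesis by (rule that)
qed

lemma waring_decomp_single: "waring_decomp d (\<lambda>x y z. c * (\<alpha> * x + \<beta> * y + \<gamma> * z) ^ d) 1"
  unfolding waring_decomp_def
  by (rule exI[of _ "\<lambda>_. c"], rule exI[of _ "\<lambda>_. \<alpha>"], rule exI[of _ "\<lambda>_. \<beta>"], rule exI[of _ "\<lambda>_. \<gamma>"]) simp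

lemma waring_decomp_add:
  assumes "waring_decomp d F r" "waring_decomp d G s"
  shows "waring_decomp d (\<lambda>x y z. F x y z + G x y z) (r + s)"
proof -
  obtain c \<alpha> \<beta> \<gamma> where F: "\<And>x y z. F x y z = (\<Sum>t<r. c t * (\<alpha> t * x + \<beta> t * y + \<gamma> t * z) ^ d)"
    using assms(1) unfolding waring_decomp_def by blast
  obtain c' \<alpha>' \<beta>' \<gamma>' where G: "\<And>x y z. G x y z = (\<Sum>t<s. c' t * (\<alpha>' t * x + \<beta>' t * y + \<gamma>' t * z) ^ d)"
    using assms(2) unfolding waring_decomp_def by blast
  let ?j = "\<lambda>f g t. if t < r then f t else g (t - r) :: complex"
  have split: "(\<Sum>t<r + s. h t) = (\<Sum>t<r. h t) + (\<Sum>t<s. h (t + r))" for h :: "nat \<Rightarrow> complex"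
    by (induction s) (auto simp: add_ac)
  show ?thesis
    unfolding waring_decomp_def
    by (rule exI[of _ "?j c c'"], rule exI[of _ "?j \<alpha> \<alpha>'"], rule exI[of _ "?j \<beta> \<beta>'"],
        rule exI[of _ "?j \<gamma> \<gamma>'"]) (simp add: split F G)
qed

lemma waring_decomp_sum:
  assumes "finite S" "\<And>s. s \<in> S \<Longrightarrow> \<exists>r. waring_decomp d (f s) r"
  shows "\<exists>r. waring_decomp d (\<lambda>x y z. \<Sum>s\<in>S. f s x y z) r"
  using assms
proof (induction S rule: finite_induct)
  case empty
  have "waring_decomp d (\<lambda>x y z. 0) 0" by (simp add: waring_decomp_def)
  then show ?case by auto
next
  case (insert s S)
  then obtain r r' where "waring_decomp d (f s) r" "waring_decomp d (\<lambda>x y z. \<Sum>s\<in>S. f s x y z) r'"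
    by (metis insertCI)
  from waring_decomp_add[OF this] insert.hyps show ?case by auto
qed

text \<open>A weighted sum of powers of x + s y + u z over a grid of roots of unity s, u isolates
  the exponents \<open>j\<close> and \<open>l\<close>, and thereby \<open>i\<close>.\<close>

lemma waring_decomp_monomial:
  assumes "i + j + l = d"
  shows "\<exists>r. waring_decomp d (\<lambda>x y z. c * x ^ i * y ^ j * z ^ l) r"
proof -
  obtain w s where ws: "\<And>j'. j' \<le> d \<Longrightarrow> (\<Sum>p\<le>d. w p * s p ^ j') = (if j' = j then 1 else 0 :: complex)"
    using roots_of_unity_extract[of j d] assms by auto
  obtain v u where vu: "\<And>l'. l' \<le> d \<Longrightarrow> (\<Sum>q\<le>d. v q * u q ^ l') = (if l' = l then 1 else 0 :: complex)"
    using roots_of_unity_extract[of l d] assms by auto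
  define C :: complex where "C = of_nat (d choose i) * of_nat ((d - i) choose j)"
  have C: "C \<noteq> 0" using assms by (auto simp: C_def)
  let ?S = "{..d} \<times> {..d}"
  let ?w = "\<lambda>t. w (fst t) * v (snd t)"
  have "c * x ^ i * y ^ j * z ^ l
      = (\<Sum>t\<in>?S. c / C * ?w t * (1 * x + s (fst t) * y + u (snd t) * z) ^ d)" for x y z
  proof -
    \<comment> \<open>The moments over the grid factor into one sum for each coordinate.\<close>
    have mom: "(\<Sum>t\<in>?S. ?w t * (1 ^ i' * s (fst t) ^ j' * u (snd t) ^ l'))
        = (if j' = j then 1 else 0) * (if l' = l then 1 else 0)" if "j' \<le> d" "l' \<le> d" for i' j' l'
      unfolding ws[OF that(1), symmetric] vu[OF that(2), symmetric] sum_product sum.cartesian_product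
      by (intro sum.cong refl) (auto simp: mult_ac)
    have "(\<Sum>t\<in>?S. ?w t * (1 * x + s (fst t) * y + u (snd t) * z) ^ d)
        = form3 d (multinomial_form d (\<lambda>i' j' l'.
            \<Sum>t\<in>?S. ?w t * (1 ^ i' * s (fst t) ^ j' * u (snd t) ^ l'))) x y z"
      by (rule power_sum_eq_multinomial_form)
    also have "\<dots> = (\<Sum>i'\<le>d. \<Sum>j'\<le>d - i'. if j' = j then if i' = i then C * x ^ i * y ^ j * z ^ l else 0 else 0)"
      unfolding form3_def
    proof (intro sum.cong refl)
      fix i' j' assume "i' \<in> {..d}" "j' \<in> {..d - i'}"
      then have *: "j' \<le> d" "d - i' - j' \<le> d" and
        **: "j' = j \<Longrightarrow> d - i' - j' = l \<longleftrightarrow> i' = i" using assms by auto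
      show "multinomial_form d (\<lambda>i' j' l'. \<Sum>t\<in>?S. ?w t * (1 ^ i' * s (fst t) ^ j' * u (snd t) ^ l'))
          (i', j', d - i' - j') * x ^ i' * y ^ j' * z ^ (d - i' - j')
        = (if j' = j then if i' = i then C * x ^ i * y ^ j * z ^ l else 0 else 0)"
        unfolding multinomial_form_def prod.case mom[OF *] using ** by (auto simp: C_def)
    qed
    also have "\<dots> = (\<Sum>i'\<le>d. if i' = i then C * x ^ i * y ^ j * z ^ l else 0)"
      using assms by (intro sum.cong refl) auto
    also have "\<dots> = C * x ^ i * y ^ j * z ^ l" using assms by simp
    finally have "(\<Sum>t\<in>?S. c / C * (?w t * (1 * x + s (fst t) * y + u (snd t) * z) ^ d))
        = c / C * (C * x ^ i * y ^ j * z ^ l)" by (simp only: flip: sum_distrib_left)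
    then show ?thesis using C by (simp add: mult_ac)
  qed
  moreover have "\<exists>r. waring_decomp d (\<lambda>x y z.
      \<Sum>t\<in>?S. c / C * ?w t * (1 * x + s (fst t) * y + u (snd t) * z) ^ d) r"
    by (rule waring_decomp_sum) (use waring_decomp_single in blast)+
  ultimately show ?thesis by simp
qed

text \<open>This ensures that the \<open>LEAST\<close> in \<open>waring_rank\<close> is attained by
  an actual decomposition.\<close>

lemma waring_decomp_exists: "\<exists>r. waring_decomp d (form3 d a) r"
  unfolding form3_def by (intro waring_decomp_sum waring_decomp_monomial) auto

section \<open>Lower bound from the moments\<close>

text \<open>Apolarity: pairing the moments with a form times X^i Y^j Z^l is a weighted sum of the
  values of that product at the points.\<close>

lemma sum_moments_swap:
  fixes \<alpha> \<beta> \<gamma> c :: "'t \<Rightarrow> 'a::comm_semiring_1"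
  shows "(\<Sum>(a, b)\<in>P. e (a, b) * (\<Sum>t\<in>T. c t * (\<alpha> t ^ (m - a - b + i) * \<beta> t ^ (a + j) * \<gamma> t ^ (b + l))))
    = (\<Sum>t\<in>T. c t * (\<alpha> t ^ i * \<beta> t ^ j * \<gamma> t ^ l) *
        homogenization P e m (\<alpha> t) (\<beta> t) (\<gamma> t))"
  unfolding homogenization_def sum_distrib_left case_prod_unfold
  by (subst sum.swap) (simp add: power_add mult_ac)

lemma moments_lower_bound:
  fixes c \<alpha> \<beta> \<gamma> :: "nat \<Rightarrow> complex"
  assumes k: "k \<ge> 1"
    and moments: "\<And>i j l. i + j + l = 2 * k + 1 \<Longrightarrow> (\<Sum>t<r. c t * (\<alpha> t ^ i * \<beta> t ^ j * \<gamma> t ^ l))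
      = (if (i, j, l) = (1, k - 1, k + 1) \<or> (i, j, l) = (0, 2 * k, 1) then 1 else 0)"
  shows "(k + 1)\<^sup>2 < r"
proof (rule ccontr)
  assume "\<not> (k + 1)\<^sup>2 < r"
  then have r: "r \<le> k * (k + 2) + 1" by (simp add: power2_eq_square algebra_simps)
  define T where "T = {t. t < r \<and> \<alpha> t \<noteq> 0}"
  define Z where "Z = {t. t < r \<and> \<alpha> t = 0}"
  have fin: "finite T" "finite Z" by (auto simp: T_def Z_def)
  have TZ: "card T + card Z = r"
  proof -
    have "{..<r} = T \<union> Z" "T \<inter> Z = {}" by (auto simp: T_def Z_def)
    then show ?thesis using card_Un_disjoint[OF fin] by (metis card_lessThan)
  qed
  have nz: "\<alpha> t \<noteq> 0" if "t \<in> T" for t using that by (simp add: T_def)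
  define B where "B = {..<k} \<times> {..<k + 2}"
  have B: "finite B" "card B = k * (k + 2)" by (auto simp: B_def)
  define H where "H P e m t = homogenization P e m (\<alpha> t) (\<beta> t) (\<gamma> t)"
    for P m t and e :: "nat \<times> nat \<Rightarrow> complex"
  \<comment> \<open>If, among the monomials of degree at most \<open>m\<close>, the multiplier X^i
    Y^j Z^l carries only Y^\<open>a\<^sub>0\<close> Z^\<open>b\<^sub>0\<close> (homogenised) to one
    of the two nonzero moments, the pairing reads off its coefficient.\<close>
  have apolar: "(\<Sum>t<r. c t * (\<alpha> t ^ i * \<beta> t ^ j * \<gamma> t ^ l) * H P e m t)
      = (if (a\<^sub>0, b\<^sub>0) \<in> P then e (a\<^sub>0, b\<^sub>0) else 0)"
    if "finite P" "i + j + l + m = 2 * k + 1"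
      and deg: "\<And>a b. (a, b) \<in> P \<Longrightarrow> e (a, b) \<noteq> 0 \<Longrightarrow> a + b \<le> m"
      and ind: "\<And>a b. a + b \<le> m \<Longrightarrow>
        (m - a - b + i, a + j, b + l) = (1, k - 1, k + 1) \<or> (m - a - b + i, a + j, b + l) = (0, 2 * k, 1)
          \<longleftrightarrow> (a, b) = (a\<^sub>0, b\<^sub>0)"
    for P e i j l m a\<^sub>0 b\<^sub>0
  proof -
    have "(\<Sum>t<r. c t * (\<alpha> t ^ i * \<beta> t ^ j * \<gamma> t ^ l) * H P e m t)
      = (\<Sum>(a, b)\<in>P. e (a, b) * (\<Sum>t<r. c t * (\<alpha> t ^ (m - a - b + i) * \<beta> t ^ (a + j) * \<gamma> t ^ (b + l))))"
      unfolding H_def by (rule sum_moments_swap[symmetric])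
    also have "\<dots> = (\<Sum>p\<in>P. if p = (a\<^sub>0, b\<^sub>0) then e p else 0)"
    proof (rule sum.cong[OF refl], clarify)
      fix a b assume ab: "(a, b) \<in> P"
      show "e (a, b) * (\<Sum>t<r. c t * (\<alpha> t ^ (m - a - b + i) * \<beta> t ^ (a + j) * \<gamma> t ^ (b + l)))
        = (if (a, b) = (a\<^sub>0, b\<^sub>0) then e (a, b) else 0)"
      proof (cases "e (a, b) = 0")
        case False
        then have le: "a + b \<le> m" using deg ab by blast
        then have "m - a - b + i + (a + j) + (b + l) = 2 * k + 1" using that(2) by linarith
        from moments[OF this] show ?thesis unfolding ind[OF le] by simp
      qed auto
    qed
    also have "\<dots> = (if (a\<^sub>0, b\<^sub>0) \<in> P then e (a\<^sub>0, b\<^sub>0) else 0)" using \<open>finite P\<close> by simp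
    finally show ?thesis .
  qed
  \<comment> \<open>The multiplier X Y^(k-1-\<open>a\<^sub>0\<close>)
    Z^(k+1-\<open>b\<^sub>0\<close>) carries the top monomial to X Y^(k-1) Z^(k+1). Its factor X
    kills the points on the line and excludes the moment at Y^(2k) Z.\<close>
  have top_zero: "e (a\<^sub>0, b\<^sub>0) = 0"
    if "finite P" and deg: "\<And>a b. (a, b) \<in> P \<Longrightarrow> e (a, b) \<noteq> 0 \<Longrightarrow> a + b \<le> m"
      and van: "\<And>t. t \<in> T \<Longrightarrow> H P e m t = 0"
      and P: "(a\<^sub>0, b\<^sub>0) \<in> P" and ab: "(a\<^sub>0, b\<^sub>0) \<in> B" "a\<^sub>0 + b\<^sub>0 = m"
    for P e m a\<^sub>0 b\<^sub>0
  proof -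
    have lt: "a\<^sub>0 < k" "b\<^sub>0 < k + 2" using ab(1) by (auto simp: B_def)
    have "e (a\<^sub>0, b\<^sub>0)
        = (\<Sum>t<r. c t * (\<alpha> t ^ 1 * \<beta> t ^ (k - 1 - a\<^sub>0) * \<gamma> t ^ (k + 1 - b\<^sub>0)) * H P e m t)"
      by (subst apolar[of P _ _ _ m e a\<^sub>0 b\<^sub>0]) (use that lt k in auto)
    also have "\<dots> = 0"
    proof (rule sum.neutral, rule ballI)
      fix t assume "t \<in> {..<r}"
      then show "c t * (\<alpha> t ^ 1 * \<beta> t ^ (k - 1 - a\<^sub>0) * \<gamma> t ^ (k + 1 - b\<^sub>0)) * H P e m t = 0"
        using van[of t] by (cases "\<alpha> t = 0") (auto simp: T_def)
    qed
    finally show ?thesis .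
  qed
  note vanishing = exists_vanishing_form[where \<alpha> = \<alpha> and \<beta> = \<beta> and \<gamma> = \<gamma>, folded H_def]
  \<comment> \<open>As r \<le> k(k+2) + 1, at most k(k+2) - 1, k(k+2) + 1 or k(k+2) points lie off
    the line in the three cases. Each case uses one monomial more than that: \<open>B\<close> with
    0, 2 or 1 added.\<close>
  consider "card Z \<ge> 2" | "Z = {}" | "card Z = 1"
    using fin(2) by (metis One_nat_def card_eq_0_iff less_2_cases not_less)
  then show False
  proof cases
    case 1
    then have "card T < card B" using TZ r B by linarith
    then obtain e m a b where e: "\<forall>a b. (a, b) \<in> B \<longrightarrow> e (a, b) \<noteq> 0 \<longrightarrow> a + b \<le> m"
      "(a, b) \<in> B" "a + b = m" "e (a, b) \<noteq> 0" "\<forall>t\<in>T. H B e m t = 0"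
      by (rule vanishing[OF fin(1) B(1) _ nz])
    then show False using top_zero[OF B(1) e(1,5)[rule_format] e(2,2,3)] by simp
  next
    case 2
    define P where "P = insert (k, 0) (insert (k, 1) B)"
    have P: "finite P" "card P = k * (k + 2) + 2" using B by (auto simp: P_def B_def)
    have "card T < card P" using TZ r P by linarith
    then obtain e m a b where e: "\<forall>a b. (a, b) \<in> P \<longrightarrow> e (a, b) \<noteq> 0 \<longrightarrow> a + b \<le> m"
      "(a, b) \<in> P" "a + b = m" "e (a, b) \<noteq> 0" "\<forall>t\<in>T. H P e m t = 0"
      by (rule vanishing[OF fin(1) P(1) _ nz])
    have "(a, b) \<notin> B" using top_zero[OF P(1) e(1,5)[rule_format] e(2) _ e(3)] e(4) by auto
    then have ab: "a = k" "b = 0 \<or> b = 1" using e(2) by (auto simp: P_def)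
    \<comment> \<open>With no point on the line, a multiplier without X is allowed: Y^k Z^(1-b)
      carries Y^k Z^b to Y^(2k) Z.\<close>
    have "(\<Sum>t<r. c t * (\<alpha> t ^ 0 * \<beta> t ^ k * \<gamma> t ^ (1 - b)) * H P e m t) = e (a, b)"
      by (subst apolar[of P _ _ _ m e a b]) (use P(1) e ab k in auto)
    moreover have "H P e m t = 0" if "t < r" for t using e(5) that 2 by (auto simp: T_def Z_def)
    ultimately show False using e(4) by simp
  next
    case 3
    then obtain t\<^sub>0 where Z: "Z = {t\<^sub>0}" by (metis card_1_singletonE)
    then have t\<^sub>0: "t\<^sub>0 < r" by (auto simp: Z_def)
    define P where "P = insert (k, 0) B"
    have P: "finite P" "card P = k * (k + 2) + 1" using B by (auto simp: P_def B_def)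
    have "card T < card P" using TZ r P 3 by linarith
    then obtain e m a b where e: "\<forall>a b. (a, b) \<in> P \<longrightarrow> e (a, b) \<noteq> 0 \<longrightarrow> a + b \<le> m"
      "(a, b) \<in> P" "a + b = m" "e (a, b) \<noteq> 0" "\<forall>t\<in>T. H P e m t = 0"
      by (rule vanishing[OF fin(1) P(1) _ nz])
    have "(a, b) \<notin> B" using top_zero[OF P(1) e(1,5)[rule_format] e(2) _ e(3)] e(4) by auto
    then have ab: "a = k" "b = 0" "m = k" using e(2,3) by (auto simp: P_def)
    \<comment> \<open>Only the point \<open>t\<^sub>0\<close> on the line contributes; testing against \<open>Y\<^bsup>k+1\<^esup>\<close> forces its
      contribution against \<open>Y\<^bsup>k\<^esup> Z\<close> to vanish as well.\<close>
    have single: "(\<Sum>t<r. c t * g t * H P e m t) = c t\<^sub>0 * g t\<^sub>0 * H P e m t\<^sub>0" for g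
    proof -
      have "(\<Sum>t<r. c t * g t * H P e m t) = (\<Sum>t\<in>{t\<^sub>0}. c t * g t * H P e m t)"
        using t\<^sub>0 e(5) Z by (intro sum.mono_neutral_right) (auto simp: T_def Z_def)
      then show ?thesis by simp
    qed
    \<comment> \<open>Y^(k+1) carries only Y^(k-1) Z to a nonzero moment, namely Y^(2k) Z. That
      monomial lies in \<open>B\<close> and has top degree k = m, so \<open>top_zero\<close> makes
      its coefficient vanish.\<close>
    have "(k - 1, 1) \<in> B" using k by (auto simp: B_def)
    then have "(k - 1, 1) \<in> P" "e (k - 1, 1) = 0"
      using top_zero[OF P(1) e(1,5)[rule_format], of "k - 1" 1] ab(3) k by (auto simp: P_def)
    moreover have ind: "(m - a - b + 0, a + (k + 1), b + 0) = (1, k - 1, k + 1)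
        \<or> (m - a - b + 0, a + (k + 1), b + 0) = (0, 2 * k, 1) \<longleftrightarrow> (a, b) = (k - 1, 1)"
      if "a + b \<le> m" for a b
      using that ab(3) k unfolding prod.inject by presburger
    ultimately have "(\<Sum>t<r. c t * (\<alpha> t ^ 0 * \<beta> t ^ (k + 1) * \<gamma> t ^ 0) * H P e m t) = 0"
      using apolar[OF P(1) _ e(1)[rule_format] ind] ab(3) by simp
    \<comment> \<open>One of \<open>c t\<^sub>0\<close>, \<open>\<beta> t\<^sub>0\<close> and
      \<open>H P e m t\<^sub>0\<close> must be zero, and for k \<ge> 1 each of them still divides
      this product.\<close>
    then have "c t\<^sub>0 * \<beta> t\<^sub>0 ^ k * \<gamma> t\<^sub>0 * H P e m t\<^sub>0 = 0"
      unfolding single using k by auto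
    then have "(\<Sum>t<r. c t * (\<alpha> t ^ 0 * \<beta> t ^ k * \<gamma> t ^ 1) * H P e m t) = 0"
      unfolding single by simp
    \<comment> \<open>The multiplier Y^k Z carries the top monomial Y^k to Y^(2k) Z, so the same
      pairing equals its nonzero coefficient.\<close>
    moreover have "(\<Sum>t<r. c t * (\<alpha> t ^ 0 * \<beta> t ^ k * \<gamma> t ^ 1) * H P e m t) = e (a, b)"
      by (subst apolar[of P _ _ _ m e a b]) (use P(1) e ab k in auto)
    ultimately show False using e(4) by simp
  qed
qed

theorem theorem1:
  fixes d :: nat
  assumes "d \<ge> 3" and "odd d"
  shows "\<exists>a. waring_rank d (form3 d a) > ((d + 1) div 2) ^ 2"
proof -
  obtain k where d: "d = 2 * k + 1" using assms(2) by (elim oddE)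
  then have k: "k \<ge> 1" using assms(1) by simp
  define M :: "nat \<Rightarrow> nat \<Rightarrow> nat \<Rightarrow> complex" where
    "M i j l = (if (i, j, l) = (1, k - 1, k + 1) \<or> (i, j, l) = (0, 2 * k, 1) then 1 else 0)" for i j l
  define r where "r = waring_rank d (form3 d (multinomial_form d M))"
  have "waring_decomp d (form3 d (multinomial_form d M)) r"
    unfolding r_def waring_rank_def using waring_decomp_exists by (rule LeastI_ex)
  then obtain c \<alpha> \<beta> \<gamma> where "\<And>x y z. form3 d (multinomial_form d M) x y z
      = (\<Sum>t<r. c t * (\<alpha> t * x + \<beta> t * y + \<gamma> t * z) ^ d)"
    unfolding waring_decomp_def by blast
  then have "(\<Sum>t<r. c t * (\<alpha> t ^ i * \<beta> t ^ j * \<gamma> t ^ l)) = M i j l" if "i + j + l = 2 * k + 1" for i j l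
    using that unfolding d by (rule moments_of_decomposition)
  then have "(k + 1)\<^sup>2 < r" unfolding M_def by (rule moments_lower_bound[OF k])
  moreover have "(d + 1) div 2 = k + 1" using d by simp
  ultimately show ?thesis unfolding r_def by metis
qed

end
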